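(* Let $G=(V,E)$ be a connected graph. Then $$m_{\lambda_k(G)}\leq (k-1)\Delta_G+\ell_G,$$ where $m_{\lambda_k(G)}$ is the multiplicity of $\lambda_k(G)$ as an eigenvalue of the adjacency matrix of $G$.
   Context: All graphs are finite, simple and undirected. The eigenvalues of the adjacency matrix of a graph $G=(V,E)$ are listed with multiplicity as $\lambda_1(G)\geq\lambda_2(G)\geq\cdots\geq\lambda_{|V|}(G)$, so $\lambda_k(G)$ is the $k$-th largest one. $\Delta_G$ denotes the maximum degree of $G$, and $\ell_G:=|E|-|V|+1$ is the cyclomatic number of $G$.
   Formalization: For k = 1 the formal theorem assumes that G is not a tree (its cyclomatic number is nonzero), since for a tree the largest eigenvalue has multiplicity 1 while the bound is 0 (e.g. a single edge); all k ≥ 2 are covered for every connected G. *)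

theory Defs
  imports
    "Graph_Theory.Digraph_Component"
    "Jordan_Normal_Form.Char_Poly"
    "HOL-Library.Multiset"
begin

text \<open>
  A finite simple undirected graph is a \<open>pair_graph\<close>: a finite, loop-free, symmetric set of
  arcs \<open>parcs G\<close> over the vertex set \<open>pverts G\<close>. An undirected edge is represented by its two
  opposite arcs, so the edges proper are the sets \<open>{u, v}\<close>, and the degree of a vertex is its
  out-degree.
\<close>

definition edges :: "'a pair_pre_digraph \<Rightarrow> 'a set set" where
  "edges G = (\<lambda>(u, v). {u, v}) ` parcs G"

definition max_degree :: "'a pair_pre_digraph \<Rightarrow> nat" where
  "max_degree G = Max (out_degree (with_proj G) ` pverts G)"

definition cyclomatic_number :: "'a pair_pre_digraph \<Rightarrow> int" where
  "cyclomatic_number G = int (card (edges G)) - int (card (pverts G)) + 1"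

text \<open>The list \<open>vs\<close> is meant to enumerate the vertices of \<open>G\<close> without repetition.\<close>

definition adjacency_mat :: "'a list \<Rightarrow> 'a pair_pre_digraph \<Rightarrow> real mat" where
  "adjacency_mat vs G =
     mat (length vs) (length vs) (\<lambda>(i, j). if (vs ! i, vs ! j) \<in> parcs G then 1 else 0)"

text \<open>
  Real eigenvalues only, repeated according to their multiplicity as roots of the characteristic
  polynomial; for a symmetric real matrix these are all the eigenvalues, and this multiplicity
  is also the dimension of the eigenspace.
\<close>

definition eigenvalues_desc :: "real mat \<Rightarrow> real list" where
  "eigenvalues_desc A = rev (sorted_list_of_multiset (proots (char_poly A)))"

text \<open>The index \<open>k\<close> starts at 1.\<close>

definition kth_eigenvalue :: "nat \<Rightarrow> real mat \<Rightarrow> real" where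
  "kth_eigenvalue k A = eigenvalues_desc A ! (k - 1)"

definition eigenvalue_multiplicity :: "real mat \<Rightarrow> real \<Rightarrow> nat" where
  "eigenvalue_multiplicity A x = Polynomial.order x (char_poly A)"

end

theory Submission
  imports Defs
begin

text \<open>
  Put \<open>\<mu> = \<lambda>\<^sub>k(G)\<close>, let \<open>m\<close> be its multiplicity and \<open>p \<le> k - 1\<close> the number of larger
  eigenvalues. The quadratic form \<open>q x = x\<^sup>T (A - \<mu>) x\<close> has \<open>p\<close> positive squares and nullity \<open>m\<close>;
  the proof bounds \<open>m\<close> in terms of \<open>p\<close> by comparing \<open>q\<close> with a form that lives on a tree.

  Fix a spanning tree \<open>T\<close>; exactly \<open>\<ell>\<close> edges are left over. For such an edge \<open>{u, v}\<close> write
  \<open>2 x\<^sub>u x\<^sub>v = (x\<^sub>u + x\<^sub>v)\<^sup>2 - x\<^sub>u\<^sup>2 - x\<^sub>v\<^sup>2\<close>. Hence \<open>q\<close> is a form \<open>q\<^sub>T\<close>, whose off-diagonal part is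
  supported on \<open>T\<close> and whose diagonal is arbitrary, plus \<open>\<ell>\<close> squares of linear forms
  (\<open>adjacency_form_decomposition\<close>). Adding squares of linear forms never destroys a positive
  square, and \<open>\<ell>\<close> of them make at most \<open>\<ell>\<close> further directions nonnegative. So if \<open>q\<^sub>T\<close> has \<open>s\<close>
  positive squares and nullity \<open>z\<close>, then \<open>s \<le> p\<close> and \<open>p + m \<le> s + z + \<ell>\<close>
  (\<open>inertia_comparison\<close>).

  The tree form can be diagonalized from the leaves upwards
  (\<open>forest_form_diagonalization\<close>). A leaf with nonzero diagonal entry is removed by completing the
  square, which only changes the diagonal entry of its parent. A leaf with diagonal entry zero forms
  a hyperbolic plane with its parent \<open>u\<close>; splitting it off produces one positive square and deletes
  \<open>u\<close>, so the remaining forest gains at most \<open>\<Delta> - 1\<close> components. As each component accounts for at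
  most one zero, \<open>z \<le> 1 + s (\<Delta> - 1)\<close>. Altogether \<open>m \<le> 1 + (k - 1)(\<Delta> - 1) + \<ell>\<close>, which is at most
  \<open>(k - 1) \<Delta> + \<ell>\<close> as soon as \<open>k \<ge> 2\<close>.

  For \<open>k = 1\<close> this argument loses one. There \<open>\<ell> \<ge> 1\<close> by hypothesis, and \<open>m = 1\<close> by Perron: an
  eigenvector of the largest eigenvalue of a connected graph cannot vanish anywhere
  (\<open>nonpositive_adjacency_form_zero\<close>).

  Linear algebra enters in only two ways: a homogeneous system with fewer equations than unknowns has
  a nontrivial solution, and a real symmetric matrix is orthogonally diagonalizable.
\<close>

section \<open>Linear forms and homogeneous systems\<close>

text \<open>
  Vectors are functions on the vertex type, of which only the values on a finite set \<open>V\<close> matter; a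
  linear form may therefore only read these values.
\<close>
definition linear_form :: "'a set \<Rightarrow> (('a \<Rightarrow> real) \<Rightarrow> real) \<Rightarrow> bool" where
  "linear_form V f \<longleftrightarrow> (\<exists>c. \<forall>x. f x = (\<Sum>w\<in>V. c w * x w))"

lemma linear_formI: "(\<And>x. f x = (\<Sum>w\<in>V. c w * x w)) \<Longrightarrow> linear_form V f"
  unfolding linear_form_def by blast

lemma linear_form_mono:
  assumes "linear_form U f" "U \<subseteq> V" "finite V"
  shows "linear_form V f"
proof -
  obtain c where c: "\<And>x. f x = (\<Sum>w\<in>U. c w * x w)"
    using assms(1) unfolding linear_form_def by blast
  show ?thesis
  proof (rule linear_formI)
    show "f x = (\<Sum>w\<in>V. (if w \<in> U then c w else 0) * x w)" for x
      unfolding c using assms(2,3) by (intro sum.mono_neutral_cong_left) auto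
  qed
qed

lemma linear_form_coordinate:
  assumes "finite V" "v \<in> V"
  shows "linear_form V (\<lambda>x. x v)"
  by (rule linear_formI[where c = "\<lambda>w. if w = v then 1 else 0"])
    (use assms in \<open>simp add: if_distrib[of "\<lambda>z. z * _"] cong: if_cong\<close>)

lemma linear_form_add:
  assumes "linear_form V f" "linear_form V g"
  shows "linear_form V (\<lambda>x. f x + g x)"
proof -
  obtain c d where "\<And>x. f x = (\<Sum>w\<in>V. c w * x w)" "\<And>x. g x = (\<Sum>w\<in>V. d w * x w)"
    using assms unfolding linear_form_def by blast
  then show ?thesis
    by (intro linear_formI[where c = "\<lambda>w. c w + d w"]) (simp add: algebra_simps sum.distrib)
qed

lemma linear_form_scale:
  assumes "linear_form V f"
  shows "linear_form V (\<lambda>x. a * f x)"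
proof -
  obtain c where "\<And>x. f x = (\<Sum>w\<in>V. c w * x w)"
    using assms unfolding linear_form_def by blast
  then show ?thesis
    by (intro linear_formI[where c = "\<lambda>w. a * c w"]) (simp add: sum_distrib_left mult_ac)
qed

lemma linear_form_sum:
  assumes "finite J" "\<And>j. j \<in> J \<Longrightarrow> linear_form V (f j)"
  shows "linear_form V (\<lambda>x. \<Sum>j\<in>J. f j x)"
  using assms
proof (induction J)
  case empty
  show ?case by (rule linear_formI[where c = "\<lambda>w. 0"]) simp
next
  case (insert j J)
  then show ?case by (simp add: linear_form_add)
qed

text \<open>
  Gaussian elimination: an equation that is not identically zero is solved for one variable \<open>w\<close>,
  and substituting the solution leaves one equation and one unknown fewer.
\<close>
lemma homogeneous_system_nontrivial_solution:
  assumes "finite J" "finite V" "card J < card V" "\<And>j. j \<in> J \<Longrightarrow> linear_form V (f j)"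
  shows "\<exists>x. (\<exists>v\<in>V. x v \<noteq> 0) \<and> (\<forall>j\<in>J. f j x = 0)"
  using assms
proof (induction J arbitrary: V f)
  case empty
  then have "V \<noteq> {}" by auto
  then show ?case by (intro exI[of _ "\<lambda>_. 1"]) auto
next
  case (insert j J)
  obtain c where c: "\<And>x. f j x = (\<Sum>w\<in>V. c w * x w)"
    using insert.prems(3)[of j] unfolding linear_form_def by blast
  show ?case
  proof (cases "\<forall>w\<in>V. c w = 0")
    case True
    then have 0: "f j x = 0" for x unfolding c by simp
    have "\<exists>x. (\<exists>v\<in>V. x v \<noteq> 0) \<and> (\<forall>j\<in>J. f j x = 0)"
      using insert.prems insert.hyps by (intro insert.IH) auto
    then show ?thesis using 0 by auto
  next
    case False
    then obtain w where w: "w \<in> V" "c w \<noteq> 0" by blast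
    let ?U = "V - {w}"
    define s where "s x = x(w := - (\<Sum>t\<in>?U. c t * x t) / c w)" for x
    have split: "(\<Sum>t\<in>V. e t * s x t) = (\<Sum>t\<in>?U. (e t - e w * c t / c w) * x t)" for e x
    proof -
      have "(\<Sum>t\<in>V. e t * s x t) = e w * s x w + (\<Sum>t\<in>?U. e t * s x t)"
        using w insert.prems(1) by (simp add: sum.remove)
      also have "(\<Sum>t\<in>?U. e t * s x t) = (\<Sum>t\<in>?U. e t * x t)"
        by (rule sum.cong) (auto simp: s_def)
      also have "e w * s x w = - (\<Sum>t\<in>?U. e w * c t / c w * x t)"
        by (simp add: s_def sum_divide_distrib sum_distrib_left mult.assoc)
      finally show ?thesis
        by (simp add: algebra_simps sum_subtractf)
    qed
    have "\<exists>x. (\<exists>v\<in>?U. x v \<noteq> 0) \<and> (\<forall>i\<in>J. f i (s x) = 0)"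
    proof (rule insert.IH)
      fix i assume "i \<in> J"
      then obtain e where "\<And>x. f i x = (\<Sum>t\<in>V. e t * x t)"
        using insert.prems(3)[of i] unfolding linear_form_def by blast
      then show "linear_form ?U (\<lambda>x. f i (s x))"
        by (intro linear_formI) (simp only: split)
    qed (use insert.prems insert.hyps w in auto)
    then obtain x v where x: "v \<in> ?U" "x v \<noteq> 0" "\<forall>i\<in>J. f i (s x) = 0" by blast
    have "f j (s x) = 0" unfolding c split using w(2) by simp
    moreover have "s x v \<noteq> 0" using x(1,2) by (simp add: s_def)
    ultimately show ?thesis using x by (intro exI[of _ "s x"]) auto
  qed
qed

section \<open>Sums of squares and inertia\<close>

text \<open>
  The third clause says that the forms \<open>L v\<close> are linearly independent; there are \<open>card V\<close> of them,
  so they are coordinates on the vectors supported in \<open>V\<close>, and the signs of the \<open>d v\<close> give the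
  inertia of \<open>q\<close>.
\<close>
definition diagonalizes :: "'a set \<Rightarrow> (('a \<Rightarrow> real) \<Rightarrow> real) \<Rightarrow>
    ('a \<Rightarrow> real) \<Rightarrow> ('a \<Rightarrow> ('a \<Rightarrow> real) \<Rightarrow> real) \<Rightarrow> bool" where
  "diagonalizes V q d L \<longleftrightarrow> (\<forall>v\<in>V. linear_form V (L v)) \<and>
     (\<forall>x. q x = (\<Sum>v\<in>V. d v * (L v x)\<^sup>2)) \<and>
     (\<forall>x. (\<forall>v\<in>V. L v x = 0) \<longrightarrow> (\<forall>v\<in>V. x v = (0::real)))"

text \<open>
  Completing a square splits off one vertex \<open>v\<close>. The form \<open>l\<close> is an admissible new coordinate
  because together with the values on \<open>V\<close> it determines \<open>x v\<close>.
\<close>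
lemma diagonalizes_insert:
  assumes dl: "diagonalizes V q' d L" and "finite V" "v \<notin> V"
    and l: "linear_form (insert v V) l"
    and q: "\<And>x. q x = a * (l x)\<^sup>2 + q' x"
    and inj: "\<And>x. l x = 0 \<Longrightarrow> \<forall>w\<in>V. x w = 0 \<Longrightarrow> x v = 0"
  shows "diagonalizes (insert v V) q (d(v := a)) (L(v := l))"
  unfolding diagonalizes_def
proof (intro conjI ballI allI impI)
  show "linear_form (insert v V) ((L(v := l)) w)" if "w \<in> insert v V" for w
    using that dl l \<open>finite V\<close> unfolding diagonalizes_def
    by (auto intro: linear_form_mono)
  show "q x = (\<Sum>w\<in>insert v V. (d(v := a)) w * ((L(v := l)) w x)\<^sup>2)" for x
  proof -
    have "(\<Sum>w\<in>V. (d(v := a)) w * ((L(v := l)) w x)\<^sup>2) = (\<Sum>w\<in>V. d w * (L w x)\<^sup>2)"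
      using \<open>v \<notin> V\<close> by (intro sum.cong) auto
    then show ?thesis using assms(2,3) dl unfolding q diagonalizes_def by simp
  qed
next
  fix x w assume *: "\<forall>w\<in>insert v V. (L(v := l)) w x = 0" and w: "w \<in> insert v V"
  have "\<forall>w\<in>V. L w x = 0" using * \<open>v \<notin> V\<close> by (metis fun_upd_other insertCI)
  then have "\<forall>w\<in>V. x w = 0" using dl unfolding diagonalizes_def by blast
  moreover have "l x = 0" using * by auto
  ultimately show "x w = 0" using w inj by blast
qed

lemma card_filter_insert_upd:
  assumes "finite V" "v \<notin> V"
  shows "card {w \<in> insert v V. P ((d(v := a)) w)} = (if P a then 1 else 0) + card {w \<in> V. P (d w)}"
proof -
  have "{w \<in> insert v V. P ((d(v := a)) w)} = (if P a then {v} else {}) \<union> {w \<in> V. P (d w)}"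
    using assms by auto
  then show ?thesis using assms by auto
qed

lemma card_filter_split:
  "finite A \<Longrightarrow> card A = card {a \<in> A. P a} + card {a \<in> A. \<not> P a}"
  by (subst card_Un_disjoint[symmetric]) (auto intro: arg_cong[of _ _ card])

lemma card_nonneg_split:
  fixes f :: "'a \<Rightarrow> real"
  assumes "finite A"
  shows "card {a \<in> A. f a \<ge> 0} = card {a \<in> A. f a > 0} + card {a \<in> A. f a = 0}"
proof -
  have "{a \<in> A. f a \<ge> 0} = {a \<in> A. f a > 0} \<union> {a \<in> A. f a = 0}" by auto
  also have "card \<dots> = card {a \<in> A. f a > 0} + card {a \<in> A. f a = 0}"
    using assms by (intro card_Un_disjoint) auto
  finally show ?thesis .
qed

text \<open>
  This is the counting argument behind Sylvester's law of inertia. If a count were too large, there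
  would be fewer linear conditions than unknowns, and some nonzero \<open>x\<close> would satisfy all of
  them. In the first case the conditions kill the positive squares of \<open>q\<close> and the nonpositive
  ones of \<open>p\<close>, so that \<open>q x \<le> 0 < p x \<le> q x\<close>. In the second case they kill the negative squares
  of \<open>q\<close>, the nonnegative ones of \<open>p\<close> and all \<open>g j\<close>, so that \<open>0 \<le> q x = p x < 0\<close>.
\<close>
lemma inertia_comparison:
  assumes "finite V" "finite I" "card I = card V" "finite J"
    and y: "\<And>i. i \<in> I \<Longrightarrow> linear_form V (y i)"
    and g: "\<And>j. j \<in> J \<Longrightarrow> linear_form V (g j)"
    and dl: "diagonalizes V p d L"
    and q: "\<And>x. q x = (\<Sum>i\<in>I. e i * (y i x)\<^sup>2)"
    and pq: "\<And>x. q x = p x + (\<Sum>j\<in>J. (g j x)\<^sup>2)"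
  shows "card {v \<in> V. d v > 0} \<le> card {i \<in> I. e i > 0}"
    and "card {i \<in> I. e i \<ge> 0} \<le> card {v \<in> V. d v \<ge> 0} + card J"
proof -
  have L: "\<And>v. v \<in> V \<Longrightarrow> linear_form V (L v)" and p: "\<And>x. p x = (\<Sum>v\<in>V. d v * (L v x)\<^sup>2)"
    and inj: "\<And>x v. \<forall>v\<in>V. L v x = 0 \<Longrightarrow> v \<in> V \<Longrightarrow> x v = 0"
    using dl unfolding diagonalizes_def by blast+
  show "card {v \<in> V. d v > 0} \<le> card {i \<in> I. e i > 0}"
  proof (rule ccontr)
    assume neg: "\<not> ?thesis"
    let ?f = "case_sum y L"
    let ?K = "{i \<in> I. e i > 0} <+> {v \<in> V. \<not> d v > 0}"
    have "\<exists>x. (\<exists>v\<in>V. x v \<noteq> 0) \<and> (\<forall>k\<in>?K. ?f k x = 0)"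
    proof (rule homogeneous_system_nontrivial_solution)
      show "card ?K < card V"
        using neg assms(1,2) card_Plus[of "{i \<in> I. e i > 0}" "{v \<in> V. \<not> d v > 0}"]
          card_filter_split[OF assms(1), of "\<lambda>v. d v > 0"] by simp
    qed (use assms(1,2) y L in auto)
    then obtain x where x: "\<exists>v\<in>V. x v \<noteq> 0" and fx: "\<And>k. k \<in> ?K \<Longrightarrow> ?f k x = 0" by blast
    have y0: "y i x = 0" if "i \<in> I" "e i > 0" for i using fx[of "Inl i"] that by auto
    have L0: "L v x = 0" if "v \<in> V" "\<not> d v > 0" for v using fx[of "Inr v"] that by auto
    obtain v where v: "v \<in> V" "L v x \<noteq> 0" using x inj by blast
    have "e i * (y i x)\<^sup>2 \<le> 0" if "i \<in> I" for i
      by (cases "e i > 0") (use y0[OF that] in \<open>auto simp: mult_le_0_iff\<close>)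
    then have "q x \<le> 0" unfolding q by (rule sum_nonpos)
    moreover have "p x > 0" unfolding p
    proof (rule sum_pos2[OF assms(1) v(1)])
      show "0 < d v * (L v x)\<^sup>2" using v L0[of v] by (cases "d v > 0") auto
      show "0 \<le> d w * (L w x)\<^sup>2" if "w \<in> V" for w
        by (cases "d w > 0") (use L0[OF that] in auto)
    qed
    moreover have "(\<Sum>j\<in>J. (g j x)\<^sup>2) \<ge> 0" by (simp add: sum_nonneg)
    ultimately show False using pq[of x] by linarith
  qed
  show "card {i \<in> I. e i \<ge> 0} \<le> card {v \<in> V. d v \<ge> 0} + card J"
  proof (rule ccontr)
    assume neg: "\<not> ?thesis"
    let ?f = "case_sum y (case_sum L g)"
    let ?K = "{i \<in> I. \<not> e i \<ge> 0} <+> {v \<in> V. d v \<ge> 0} <+> J"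
    have "\<exists>x. (\<exists>v\<in>V. x v \<noteq> 0) \<and> (\<forall>k\<in>?K. ?f k x = 0)"
    proof (rule homogeneous_system_nontrivial_solution)
      show "card ?K < card V"
        using neg assms(1-4) card_filter_split[OF assms(2), of "\<lambda>i. e i \<ge> 0"] by (simp add: card_Plus)
    qed (use assms(1,2,4) y L g in auto)
    then obtain x where x: "\<exists>v\<in>V. x v \<noteq> 0" and fx: "\<And>k. k \<in> ?K \<Longrightarrow> ?f k x = 0" by blast
    have y0: "y i x = 0" if "i \<in> I" "\<not> e i \<ge> 0" for i using fx[of "Inl i"] that by auto
    have L0: "L v x = 0" if "v \<in> V" "d v \<ge> 0" for v using fx[of "Inr (Inl v)"] that by auto
    have g0: "g j x = 0" if "j \<in> J" for j using fx[of "Inr (Inr j)"] that by auto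
    obtain v where v: "v \<in> V" "L v x \<noteq> 0" using x inj by blast
    have "e i * (y i x)\<^sup>2 \<ge> 0" if "i \<in> I" for i
      by (cases "e i \<ge> 0") (use y0[OF that] in auto)
    then have "q x \<ge> 0" unfolding q by (rule sum_nonneg)
    moreover have "- p x > 0" unfolding p sum_negf[symmetric]
    proof (rule sum_pos2[OF assms(1) v(1)])
      show "0 < - (d v * (L v x)\<^sup>2)" using v L0[of v] by (cases "d v \<ge> 0") (auto simp: mult_less_0_iff)
      show "0 \<le> - (d w * (L w x)\<^sup>2)" if "w \<in> V" for w
        by (cases "d w \<ge> 0") (use L0[OF that] in \<open>auto simp: mult_le_0_iff\<close>)
    qed
    moreover have "(\<Sum>j\<in>J. (g j x)\<^sup>2) = 0" using g0 by simp
    ultimately show False using pq[of x] by linarith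
  qed
qed

section \<open>Quadratic forms on forests\<close>

text \<open>
  An arc of \<open>F\<close> leads from a vertex to its parent, so \<open>single_valued F\<close> says that parents are unique
  and \<open>F\<inverse> `` {u}\<close> is the set of children of \<open>u\<close>.
\<close>
definition forest_form :: "('a \<Rightarrow> real) \<Rightarrow> 'a set \<Rightarrow> ('a \<times> 'a) set \<Rightarrow> ('a \<Rightarrow> real) \<Rightarrow> real" where
  "forest_form b V F x = (\<Sum>v\<in>V. b v * (x v)\<^sup>2) + 2 * (\<Sum>(v, u)\<in>F. x v * x u)"

text \<open>
  For a forest, \<open>card V - card F\<close> is the number of components, so the bound says: at most one zero
  per component and \<open>D\<close> more for each positive square. Stated with this difference the induction
  needs no notion of component. It removes a vertex \<open>v\<close> of maximal height, which has no children. If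
  \<open>v\<close> has no parent, it is a component by itself. Otherwise let \<open>u\<close> be its parent. If \<open>b v \<noteq> 0\<close>,
  then completing the square removes \<open>v\<close> and one arc. If \<open>b v = 0\<close>, then \<open>x\<^sub>u\<close> is a factor of
  everything in the form that involves \<open>u\<close> or \<open>v\<close>; both vertices go, at the price of the at most
  \<open>D + 2\<close> arcs at \<open>u\<close>, and one positive square appears to pay for the \<open>D\<close> components gained.
\<close>
lemma forest_form_diagonalization:
  fixes h :: "'a \<Rightarrow> nat"
  assumes "finite V" "F \<subseteq> V \<times> V" "single_valued F" "\<And>v u. (v, u) \<in> F \<Longrightarrow> h u < h v"
    and "\<And>u. card (F\<inverse> `` {u}) \<le> Suc D"
  shows "\<exists>d L. diagonalizes V (forest_form b V F) d L \<and>
    card {v \<in> V. d v = 0} + card F \<le> card V + D * card {v \<in> V. d v > 0}"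
  using assms
proof (induction "card V" arbitrary: V F b rule: less_induct)
  case less
  note fin = less.prems(1) and FV = less.prems(2) and sv = less.prems(3) and ht = less.prems(4)
    and child = less.prems(5)
  have finF: "finite F" using fin FV finite_subset by blast
  have subF: "card (E\<inverse> `` {u}) \<le> Suc D" if "E \<subseteq> F" for E u
  proof -
    have "finite (F\<inverse> `` {u})" by (rule finite_subset[OF _ fin]) (use FV in auto)
    then have "card (E\<inverse> `` {u}) \<le> card (F\<inverse> `` {u})" using that by (intro card_mono) auto
    then show ?thesis using child[of u] by simp
  qed
  show ?case
  proof (cases "V = {}")
    case True
    then have "F = {}" using FV by auto
    then show ?thesis using True by (auto simp: diagonalizes_def forest_form_def)
  next
    case False
    have "Max (h ` V) \<in> h ` V" using fin False by (intro Max_in) auto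
    then obtain v where v: "v \<in> V" "Max (h ` V) = h v" by blast
    have hmax: "h w \<le> h v" if "w \<in> V" for w
      using that fin unfolding v(2)[symmetric] by (intro Max_ge) auto
    have leaf: "(w, v) \<notin> F" for w using ht[of w v] hmax[of w] FV by fastforce
    define V' where "V' = V - {v}"
    have "card V = Suc (card V')" using card_Suc_Diff1[OF fin v(1)] by (simp add: V'_def)
    then have V': "finite V'" "v \<notin> V'" "V = insert v V'" "card V' < card V" "card V = Suc (card V')"
      using fin v(1) unfolding V'_def by auto
    have cards: "card {w \<in> V. P ((d(v := b v)) w)}
        = (if P (b v) then 1 else 0) + card {w \<in> V'. P (d w)}" for P and d :: "'a \<Rightarrow> real"
      unfolding V'(3) by (rule card_filter_insert_upd[OF V'(1,2)])
    show ?thesis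
    proof (cases "\<exists>u. (v, u) \<in> F")
      case False
      have FV': "F \<subseteq> V' \<times> V'" using FV False leaf unfolding V'_def by auto
      obtain d L where dL: "diagonalizes V' (forest_form b V' F) d L"
        "card {w \<in> V'. d w = 0} + card F \<le> card V' + D * card {w \<in> V'. d w > 0}"
        using less.hyps[OF V'(4) V'(1) FV' sv ht child] by blast
      have 1: "diagonalizes (insert v V') (forest_form b V F) (d(v := b v)) (L(v := \<lambda>x. x v))"
        by (rule diagonalizes_insert[OF dL(1) V'(1,2)])
          (use V' in \<open>auto simp: forest_form_def intro: linear_form_coordinate\<close>)
      have 2: "card {w \<in> V. (d(v := b v)) w = 0} + card F \<le> card V + D * card {w \<in> V. 0 < (d(v := b v)) w}"
        using dL(2) V'(5) cards[of "\<lambda>t. t = 0" d] cards[of "\<lambda>t. 0 < t" d]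
        by (simp del: fun_upd_apply split: if_splits)
      show ?thesis
        by (rule exI, rule exI, rule conjI, rule 1[folded V'(3)], rule 2)
    next
      case True
      then obtain u where u: "(v, u) \<in> F" by blast
      have uV: "u \<in> V'" "u \<noteq> v" "u \<in> V" using u leaf[of v] FV unfolding V'_def by auto
      have onlyu: "w = u" if "(v, w) \<in> F" for w using that u sv by (auto dest: single_valuedD)
      define F' where "F' = F - {(v, u)}"
      have F': "F' \<subseteq> V' \<times> V'" "F' \<subseteq> F" "F = insert (v, u) F'" "(v, u) \<notin> F'" "finite F'"
        using FV leaf u finF unfolding V'_def F'_def by (auto dest: onlyu)
      have svF': "single_valued E" if "E \<subseteq> F" for E using sv that by (rule single_valued_subset[rotated])
      have htF': "h u < h v" if "E \<subseteq> F" "(v, u) \<in> E" for E v u using ht that by blast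
      show ?thesis
      proof (cases "b v = 0")
        case False
        \<comment> \<open>Schur complement: completing the square at \<open>v\<close> lowers the diagonal entry of the parent.\<close>
        define b' where "b' = b(u := b u - 1 / b v)"
        obtain d L where dL: "diagonalizes V' (forest_form b' V' F') d L"
          "card {w \<in> V'. d w = 0} + card F' \<le> card V' + D * card {w \<in> V'. d w > 0}"
          using less.hyps[OF V'(4) V'(1) F'(1) svF'[OF F'(2)] htF'[OF F'(2)] subF[OF F'(2)], of b']
          by blast
        have sq: "forest_form b V F x = b v * (x v + 1 / b v * x u)\<^sup>2 + forest_form b' V' F' x" for x
        proof -
          have "(\<Sum>w\<in>V'. b' w * (x w)\<^sup>2) = (b u - 1 / b v) * (x u)\<^sup>2 + (\<Sum>w\<in>V' - {u}. b' w * (x w)\<^sup>2)"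
            using uV V'(1) by (simp add: sum.remove b'_def)
          also have "(\<Sum>w\<in>V' - {u}. b' w * (x w)\<^sup>2) = (\<Sum>w\<in>V' - {u}. b w * (x w)\<^sup>2)"
            by (rule sum.cong) (auto simp: b'_def)
          finally have "(\<Sum>w\<in>V'. b' w * (x w)\<^sup>2) = (\<Sum>w\<in>V'. b w * (x w)\<^sup>2) - (x u)\<^sup>2 / b v"
            using uV V'(1) by (simp add: sum.remove algebra_simps)
          moreover have "(\<Sum>w\<in>V. b w * (x w)\<^sup>2) = b v * (x v)\<^sup>2 + (\<Sum>w\<in>V'. b w * (x w)\<^sup>2)"
            using V' by simp
          moreover have "(\<Sum>(v, u)\<in>F. x v * x u) = x v * x u + (\<Sum>(v, u)\<in>F'. x v * x u)"
            using F' by simp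
          moreover have "b v * (x v + 1 / b v * x u)\<^sup>2 = b v * (x v)\<^sup>2 + 2 * (x v * x u) + (x u)\<^sup>2 / b v"
            using False by (simp add: field_simps power2_eq_square)
          ultimately show ?thesis unfolding forest_form_def by simp
        qed
        have 1: "diagonalizes (insert v V') (forest_form b V F) (d(v := b v))
            (L(v := \<lambda>x. x v + 1 / b v * x u))"
          by (rule diagonalizes_insert[OF dL(1) V'(1,2)])
            (use V' sq uV in \<open>auto intro!: linear_form_add linear_form_scale[of _ _ "1 / b v", simplified] linear_form_coordinate\<close>)
        have "card F = Suc (card F')" using F'(3-5) by simp
        then have 2: "card {w \<in> V. (d(v := b v)) w = 0} + card F \<le> card V + D * card {w \<in> V. 0 < (d(v := b v)) w}"
          using dL(2) V'(5) False cards[of "\<lambda>t. t = 0" d] cards[of "\<lambda>t. 0 < t" d]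
          by (simp del: fun_upd_apply split: if_splits)
        show ?thesis
          by (rule exI, rule exI, rule conjI, rule 1[folded V'(3)], rule 2)
      next
        case True
        define W where "W = V' - {u}"
        have "card V' = Suc (card W)" using card_Suc_Diff1[OF V'(1) uV(1)] by (simp add: W_def)
        then have W: "finite W" "u \<notin> W" "V' = insert u W" "v \<notin> W" "card W < card V" "card V = card W + 2"
          using V' uV unfolding W_def by auto
        define E where "E = {e \<in> F'. fst e = u \<or> snd e = u}"
        define H where "H = F' - E"
        have H: "H \<subseteq> W \<times> W" "H \<subseteq> F" "F' = E \<union> H" "E \<inter> H = {}" "finite E" "finite H"
          using F' unfolding H_def E_def W_def by auto
        \<comment> \<open>At most \<open>D\<close> of the arcs in \<open>E\<close> enter \<open>u\<close>, since \<open>v\<close> is a further child, and one leaves it.\<close>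
        have cardE: "card E \<le> Suc D"
        proof -
          have ch: "E \<subseteq> (\<lambda>w. (w, u)) ` (F'\<inverse> `` {u}) \<union> {e \<in> F. fst e = u}"
          proof
            fix e assume "e \<in> E"
            then have "e \<in> F'" "fst e = u \<or> snd e = u" unfolding E_def by auto
            then show "e \<in> (\<lambda>w. (w, u)) ` (F'\<inverse> `` {u}) \<union> {e \<in> F. fst e = u}"
              using F'(2) by (cases e) auto
          qed
          have fc: "finite (F'\<inverse> `` {u})" by (rule finite_subset[OF _ V'(1)]) (use F' in auto)
          have "F\<inverse> `` {u} = insert v (F'\<inverse> `` {u})" using F'(3) by auto
          moreover have "v \<notin> F'\<inverse> `` {u}" using F'(4) by auto
          ultimately have "card (F'\<inverse> `` {u}) \<le> D" using child[of u] fc by simp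
          moreover have "card {e \<in> F. fst e = u} \<le> 1"
            unfolding One_nat_def using finF sv
            by (subst card_le_Suc0_iff_eq) (auto dest: single_valuedD)
          moreover have "card E \<le> card ((\<lambda>w. (w, u)) ` (F'\<inverse> `` {u})) + card {e \<in> F. fst e = u}"
            using fc finF by (intro order_trans[OF card_mono[OF _ ch] card_Un_le]) auto
          moreover have "card ((\<lambda>w. (w, u)) ` (F'\<inverse> `` {u})) \<le> card (F'\<inverse> `` {u})"
            using fc by (rule card_image_le)
          ultimately show ?thesis by linarith
        qed
        obtain d L where dL: "diagonalizes W (forest_form b W H) d L"
          "card {w \<in> W. d w = 0} + card H \<le> card W + D * card {w \<in> W. d w > 0}"
          using less.hyps[OF W(5) W(1) H(1) svF'[OF H(2)] htF'[OF H(2)] subF[OF H(2)], of b]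
          by blast
        \<comment> \<open>The end of an arc at \<open>u\<close> that is not \<open>u\<close>.\<close>
        define far where "far = (\<lambda>(s, t). if t = u then s else (t::'a))"
        have far: "far e \<in> W" if "e \<in> E" for e
        proof -
          have "fst e \<noteq> snd e" using that ht[of "fst e" "snd e"] F'(2) unfolding E_def by auto
          then show ?thesis using that F'(1) unfolding E_def far_def W_def by auto
        qed
        define M where "M x = 2 * x v + b u * x u + 2 * (\<Sum>e\<in>E. x (far e))" for x
        have linM: "linear_form V M"
          unfolding M_def using far v uV H(5) fin W(3) V'(3)
          by (intro linear_form_add linear_form_scale linear_form_sum linear_form_coordinate) auto
        have linu: "linear_form V (\<lambda>x. x u)" using uV fin by (intro linear_form_coordinate)
        have form: "forest_form b V F x = x u * M x + forest_form b W H x" for x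
        proof -
          have "(\<Sum>(s, t)\<in>E. x s * x t) = (\<Sum>e\<in>E. x u * x (far e))"
            by (rule sum.cong) (auto simp: E_def far_def)
          then have "(\<Sum>(s, t)\<in>F. x s * x t) = x v * x u + x u * (\<Sum>e\<in>E. x (far e)) + (\<Sum>(s, t)\<in>H. x s * x t)"
            using F'(3-5) H by (simp add: sum.union_disjoint sum_distrib_left)
          moreover have "(\<Sum>w\<in>V. b w * (x w)\<^sup>2) = b u * (x u)\<^sup>2 + (\<Sum>w\<in>W. b w * (x w)\<^sup>2)"
            using W V' True by simp
          ultimately show ?thesis
            unfolding forest_form_def M_def by (simp add: algebra_simps power2_eq_square)
        qed
        \<comment> \<open>\<open>x\<^sub>u M\<close> is a hyperbolic plane: one positive and one negative square.\<close>
        define l\<^sub>1 where "l\<^sub>1 x = 1 / 2 * x u + 1 / 2 * M x" for x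
        define l\<^sub>2 where "l\<^sub>2 x = 1 / 2 * x u + (- 1 / 2) * M x" for x
        have lin: "linear_form V l\<^sub>1" "linear_form V l\<^sub>2" unfolding l\<^sub>1_def l\<^sub>2_def
          by (intro linear_form_add linear_form_scale linM linu)+
        have "x u * M x = (l\<^sub>1 x)\<^sup>2 - (l\<^sub>2 x)\<^sup>2" for x
          unfolding l\<^sub>1_def l\<^sub>2_def by (simp add: power2_eq_square algebra_simps)
        then have form': "forest_form b V F x = (l\<^sub>1 x)\<^sup>2 - (l\<^sub>2 x)\<^sup>2 + forest_form b W H x" for x
          unfolding form by simp
        define d' where "d' = d(u := 1, v := -1)"
        define L' where "L' = L(u := l\<^sub>1, v := l\<^sub>2)"
        have Veq: "V = insert v (insert u W)" using V' W by simp
        have diag: "diagonalizes V (forest_form b V F) d' L'"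
          unfolding diagonalizes_def
        proof (intro conjI ballI allI impI)
          show "linear_form V (L' w)" if "w \<in> V" for w
            using that dL(1) lin fin linear_form_mono[of W "L w" V] unfolding diagonalizes_def L'_def Veq
            by auto
          show "forest_form b V F x = (\<Sum>w\<in>V. d' w * (L' w x)\<^sup>2)" for x
          proof -
            have "(\<Sum>w\<in>W. d' w * (L' w x)\<^sup>2) = (\<Sum>w\<in>W. d w * (L w x)\<^sup>2)"
              using W by (intro sum.cong) (auto simp: d'_def L'_def)
            also have "\<dots> = forest_form b W H x" using dL(1) unfolding diagonalizes_def by simp
            finally show ?thesis
              unfolding form' unfolding Veq using W uV by (simp add: d'_def L'_def)
          qed
        next
          fix x w assume *: "\<forall>w\<in>V. L' w x = 0" and w: "w \<in> V"
          have "L w x = 0" if "w \<in> W" for w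
          proof -
            have "w \<noteq> u" "w \<noteq> v" using that W by auto
            then show ?thesis using *[rule_format, of w] that unfolding Veq L'_def by simp
          qed
          then have xW: "\<forall>w\<in>W. x w = 0" using dL(1) unfolding diagonalizes_def by blast
          have "l\<^sub>1 x = 0" "l\<^sub>2 x = 0"
            using *[rule_format, of u] *[rule_format, of v] uV v unfolding L'_def by auto
          then have xu: "x u = 0" and "M x = 0" unfolding l\<^sub>1_def l\<^sub>2_def by auto
          then have "x v = 0" using xW far unfolding M_def by simp
          then show "x w = 0" using w xW xu unfolding Veq by auto
        qed
        have cards: "card {w \<in> V. P (d' w)} = (if P (-1) then 1 else 0) + ((if P 1 then 1 else 0)
            + card {w \<in> W. P (d w)})" for P
          unfolding Veq d'_def
          using card_filter_insert_upd[of "insert u W" v P "d(u := 1)"] card_filter_insert_upd[of W u P d]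
            W uV by simp
        have "card F = Suc (card E + card H)"
          using F'(3-5) H by (simp add: card_Un_disjoint)
        then have "card {w \<in> V. d' w = 0} + card F \<le> card V + D * card {w \<in> V. d' w > 0}"
          using cards[of "\<lambda>t. t = 0"] cards[of "\<lambda>t. t > 0"] dL(2) cardE W(6) by simp
        then show ?thesis using diag by blast
      qed
    qed
  qed
qed

section \<open>Diagonalization of real symmetric matrices\<close>

lemma symmetric_mat_index:
  assumes "A \<in> carrier_mat n n" "transpose_mat A = A" "i < n" "j < n"
  shows "A $$ (i, j) = A $$ (j, i)"
  using assms index_transpose_mat(1)[of i A j] by auto

text \<open>
  A complex eigenvalue \<open>z\<close> exists. It is real because for its eigenvector \<open>v\<close> the number
  \<open>v\<^sup>* A v = z |v|\<^sup>2\<close> equals its own conjugate, by symmetry of \<open>A\<close>.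
\<close>
lemma symmetric_real_mat_has_eigenvalue:
  fixes A :: "real mat"
  assumes A: "A \<in> carrier_mat n n" and sym: "transpose_mat A = A" and n: "n > 0"
  shows "\<exists>e. eigenvalue A e"
proof -
  let ?B = "map_mat complex_of_real A"
  have B: "?B \<in> carrier_mat n n" using A by simp
  obtain zs where zs: "char_poly ?B = (\<Prod>z\<leftarrow>zs. [:- z, 1:])" "length zs = n"
    using char_poly_factorized[OF B] by blast
  obtain z where "z \<in> set zs" using n zs(2) by (cases zs) auto
  then have root: "poly (char_poly ?B) z = 0"
    unfolding zs(1) by (rule linear_poly_root)
  then obtain v where v: "v \<in> carrier_vec n" "v \<noteq> 0\<^sub>v n" "?B *\<^sub>v v = z \<cdot>\<^sub>v v"
    using B unfolding eigenvalue_root_char_poly[OF B, symmetric] eigenvalue_def eigenvector_def by auto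
  define S where "S = (\<Sum>i<n. \<Sum>j<n. complex_of_real (A $$ (i, j)) * (cnj (v $ i) * v $ j))"
  define N where "N = (\<Sum>i<n. (cmod (v $ i))\<^sup>2)"
  have "(?B *\<^sub>v v) $ i = (\<Sum>j<n. complex_of_real (A $$ (i, j)) * v $ j)" if "i < n" for i
    using that A v(1) by (simp add: scalar_prod_def lessThan_atLeast0)
  then have row: "(\<Sum>j<n. complex_of_real (A $$ (i, j)) * v $ j) = z * v $ i" if "i < n" for i
    using that v(1) unfolding v(3) by simp
  have "S = (\<Sum>i<n. cnj (v $ i) * (\<Sum>j<n. complex_of_real (A $$ (i, j)) * v $ j))"
    unfolding S_def by (simp add: sum_distrib_left mult_ac)
  also have "\<dots> = (\<Sum>i<n. z * complex_of_real ((cmod (v $ i))\<^sup>2))"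
  proof (rule sum.cong)
    fix i assume "i \<in> {..<n}"
    then show "cnj (v $ i) * (\<Sum>j<n. complex_of_real (A $$ (i, j)) * v $ j)
        = z * complex_of_real ((cmod (v $ i))\<^sup>2)"
      unfolding complex_norm_square by (subst row) (auto simp: mult_ac)
  qed simp
  finally have SN: "S = z * complex_of_real N"
    unfolding N_def by (simp add: sum_distrib_left)
  have "cnj S = (\<Sum>i<n. \<Sum>j<n. complex_of_real (A $$ (i, j)) * (v $ i * cnj (v $ j)))"
    unfolding S_def by simp
  also have "\<dots> = (\<Sum>j<n. \<Sum>i<n. complex_of_real (A $$ (i, j)) * (v $ i * cnj (v $ j)))"
    by (rule sum.swap)
  also have "\<dots> = S"
    unfolding S_def using symmetric_mat_index[OF A sym] by (intro sum.cong) (auto simp: mult_ac)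
  finally have "cnj S = S" .
  moreover have "N \<noteq> 0"
  proof
    assume "N = 0"
    then have "\<forall>i<n. v $ i = 0" unfolding N_def by (subst (asm) sum_nonneg_eq_0_iff) auto
    then have "v = 0\<^sub>v n" using v(1) by (intro eq_vecI) auto
    then show False using v(2) by simp
  qed
  ultimately have "cnj z = z" unfolding SN by simp
  then have "z = complex_of_real (Re z)" by (simp add: complex_eq_iff)
  then have "poly (map_poly complex_of_real (char_poly A)) (complex_of_real (Re z)) = 0"
    using root of_real_hom.char_poly_hom[OF A, where ?'a = complex] by metis
  then have "poly (char_poly A) (Re z) = 0" by simp
  then show ?thesis using eigenvalue_root_char_poly[OF A] by blast
qed

text \<open>
  The reflection that exchanges \<open>v\<close> with the first basis vector \<open>e\<^sub>0\<close>, in the hyperplane orthogonal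
  to \<open>w = v - e\<^sub>0\<close>, or the identity if \<open>v = e\<^sub>0\<close>. It extends the unit vector \<open>v\<close> to an orthonormal basis by an explicit formula.
\<close>
lemma householder_reflection:
  fixes v :: "real vec"
  assumes v: "v \<in> carrier_vec (Suc n)" and unit: "v \<bullet> v = 1"
  shows "\<exists>W \<in> carrier_mat (Suc n) (Suc n). transpose_mat W = W \<and> W * W = 1\<^sub>m (Suc n) \<and> col W 0 = v"
proof (cases "v = unit_vec (Suc n) 0")
  case True
  then show ?thesis by (intro bexI[of _ "1\<^sub>m (Suc n)"]) auto
next
  case False
  define w where "w i = v $ i - (if i = 0 then 1 else 0)" for i
  define s where "s = (\<Sum>i<Suc n. (w i)\<^sup>2)"
  define W where "W = mat (Suc n) (Suc n) (\<lambda>(i, j). (if i = j then 1 else 0) - 2 * w i * w j / s)"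
  have vv: "(\<Sum>i<Suc n. (v $ i)\<^sup>2) = 1"
    using unit v by (simp add: scalar_prod_def lessThan_atLeast0 power2_eq_square)
  have s: "s = - 2 * w 0"
    using vv unfolding s_def w_def by (simp add: sum.lessThan_Suc_shift power2_eq_square algebra_simps del: sum.lessThan_Suc)
  have "s \<noteq> 0"
  proof
    assume "s = 0"
    then have "\<forall>i\<in>{..<Suc n}. (w i)\<^sup>2 = 0"
      unfolding s_def by (subst (asm) sum_nonneg_eq_0_iff) auto
    then have "v = unit_vec (Suc n) 0" using v by (intro eq_vecI) (auto simp: w_def unit_vec_def)
    then show False using False by simp
  qed
  have W: "W \<in> carrier_mat (Suc n) (Suc n)" unfolding W_def by simp
  moreover have "transpose_mat W = W" by (rule eq_matI) (auto simp: W_def)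
  moreover have "W * W = 1\<^sub>m (Suc n)"
  proof (rule eq_matI)
    fix i j assume "i < dim_row (1\<^sub>m (Suc n) :: real mat)" "j < dim_col (1\<^sub>m (Suc n) :: real mat)"
    then have ij: "i < Suc n" "j < Suc n" by auto
    have "(W * W) $$ (i, j) = (\<Sum>k<Suc n. W $$ (i, k) * W $$ (k, j))"
      using ij W by (simp add: scalar_prod_def lessThan_atLeast0)
    also have "\<dots> = (\<Sum>k<Suc n. (if k = i then (if i = j then 1 else 0) - 2 * w i * w j / s else 0)
        - (if k = j then 2 * w i * w j / s else 0) + 4 * w i * w j / s\<^sup>2 * (w k)\<^sup>2)"
      by (rule sum.cong) (use ij in \<open>auto simp: W_def algebra_simps power2_eq_square\<close>)
    also have "\<dots> = (if i = j then 1 else 0) - 4 * w i * w j / s + 4 * w i * w j / s\<^sup>2 * s"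
      unfolding sum.distrib sum_subtractf s_def sum_distrib_left
      using ij by (simp del: sum.lessThan_Suc)
    also have "\<dots> = 1\<^sub>m (Suc n) $$ (i, j)"
      using \<open>s \<noteq> 0\<close> ij by (simp add: power2_eq_square)
    finally show "(W * W) $$ (i, j) = 1\<^sub>m (Suc n) $$ (i, j)" .
  qed (use W in auto)
  moreover have "col W 0 = v"
  proof (rule eq_vecI)
    fix i assume "i < dim_vec v"
    then have "i < Suc n" using v by simp
    moreover have "2 * w i * w 0 / s = - w i" using s \<open>s \<noteq> 0\<close> by (simp add: field_simps)
    ultimately show "col W 0 $ i = v $ i" by (auto simp: W_def w_def)
  qed (use v W in auto)
  ultimately show ?thesis by blast
qed

text \<open>
  Deflation: conjugating by the Householder reflection of a unit eigenvector splits off a \<open>1 \<times> 1\<close>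
  block, and by symmetry both the first column and the first row vanish outside that block.
\<close>
lemma spectral_theorem_real_symmetric:
  fixes A :: "real mat"
  assumes "A \<in> carrier_mat n n" "transpose_mat A = A"
  shows "\<exists>U es. U \<in> carrier_mat n n \<and> transpose_mat U * U = 1\<^sub>m n \<and> length es = n \<and>
    transpose_mat U * A * U = mat n n (\<lambda>(i, j). if i = j then es ! i else 0)"
  using assms
proof (induction n arbitrary: A)
  case 0
  then show ?case by (intro exI[of _ "1\<^sub>m 0"] exI[of _ "[]"]) (auto intro: eq_matI)
next
  case (Suc n)
  note A = Suc.prems(1) and sym = Suc.prems(2)
  obtain e v0 where v0: "v0 \<in> carrier_vec (Suc n)" "v0 \<noteq> 0\<^sub>v (Suc n)" "A *\<^sub>v v0 = e \<cdot>\<^sub>v v0"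
    using symmetric_real_mat_has_eigenvalue[OF A sym] A unfolding eigenvalue_def eigenvector_def by auto
  define v where "v = (1 / sqrt (v0 \<bullet> v0)) \<cdot>\<^sub>v v0"
  have "v0 \<bullet> v0 > 0"
  proof -
    have "v0 \<bullet> v0 \<noteq> 0" using v0(1,2) conjugate_square_eq_0_vec[of v0 "Suc n"] by simp
    moreover have "v0 \<bullet> v0 \<ge> 0" unfolding scalar_prod_def by (simp add: sum_nonneg)
    ultimately show ?thesis by simp
  qed
  then have v: "v \<in> carrier_vec (Suc n)" "v \<bullet> v = 1" "A *\<^sub>v v = e \<cdot>\<^sub>v v"
    using v0 A unfolding v_def
    by (auto simp: mult_mat_vec smult_smult_assoc mult.commute real_sqrt_mult_self field_simps)
  obtain W where W: "W \<in> carrier_mat (Suc n) (Suc n)" "transpose_mat W = W"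
    "W * W = 1\<^sub>m (Suc n)" "col W 0 = v"
    using householder_reflection[OF v(1,2)] by blast
  define C where "C = W * A * W"
  have C: "C \<in> carrier_mat (Suc n) (Suc n)" using W A unfolding C_def by simp
  have symC: "transpose_mat C = C"
    unfolding C_def using W A sym
    by (simp add: transpose_mult[of _ "Suc n" "Suc n" _ "Suc n"] assoc_mult_mat[of _ "Suc n" "Suc n" _ "Suc n" _ "Suc n"])
  have Wv: "W *\<^sub>v v = unit_vec (Suc n) 0"
    using W by (metis col_mult2 col_one zero_less_Suc)
  have "col C 0 = (W * A) *\<^sub>v col W 0"
    unfolding C_def using W A by (intro col_mult2[of _ "Suc n" "Suc n" _ "Suc n"]) auto
  also have "\<dots> = W *\<^sub>v (A *\<^sub>v v)"
    unfolding W(4) using W A v by (intro assoc_mult_mat_vec) auto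
  also have "\<dots> = e \<cdot>\<^sub>v unit_vec (Suc n) 0"
    unfolding v(3) using W v Wv by (simp add: mult_mat_vec)
  finally have colC: "C $$ (i, 0) = (if i = 0 then e else 0)" if "i < Suc n" for i
    using that C by (metis (no_types, lifting) carrier_matD col_def index_smult_vec(1) index_unit_vec(1)
        index_unit_vec(3) index_vec mult.right_neutral mult_zero_right zero_less_Suc)
  have rowC: "C $$ (0, j) = (if j = 0 then e else 0)" if "j < Suc n" for j
    using symmetric_mat_index[OF C symC, of 0 j] colC[OF that] that by simp
  define A' where "A' = mat n n (\<lambda>(i, j). C $$ (Suc i, Suc j))"
  have A': "A' \<in> carrier_mat n n" "transpose_mat A' = A'"
    using symmetric_mat_index[OF C symC] unfolding A'_def by (auto intro!: eq_matI)
  have Cblock: "C = four_block_mat (mat 1 1 (\<lambda>_. e)) (0\<^sub>m 1 n) (0\<^sub>m n 1) A'"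
    by (rule eq_matI) (use C A' rowC colC in \<open>auto simp: A'_def\<close>)
  obtain U' es where U': "U' \<in> carrier_mat n n" "transpose_mat U' * U' = 1\<^sub>m n" "length es = n"
    "transpose_mat U' * A' * U' = mat n n (\<lambda>(i, j). if i = j then es ! i else 0)"
    using Suc.IH[OF A'] by blast
  define Z where "Z = four_block_mat (1\<^sub>m 1) (0\<^sub>m 1 n) (0\<^sub>m n 1) U'"
  have Z: "Z \<in> carrier_mat (Suc n) (Suc n)"
    using four_block_carrier_mat[OF one_carrier_mat[of 1] U'(1)] unfolding Z_def by simp
  have ZT: "transpose_mat Z = four_block_mat (1\<^sub>m 1) (0\<^sub>m 1 n) (0\<^sub>m n 1) (transpose_mat U')"
    unfolding Z_def using U'(1)
    by (subst transpose_four_block_mat[of _ 1 1 _ n _ n]) auto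
  have "transpose_mat Z * Z = four_block_mat (1\<^sub>m 1) (0\<^sub>m 1 n) (0\<^sub>m n 1) (1\<^sub>m n)"
    unfolding ZT unfolding Z_def using U'
    by (subst mult_four_block_mat[of _ 1 1 _ n _ n _ _ 1 _ n]) auto
  then have ZZ: "transpose_mat Z * Z = 1\<^sub>m (Suc n)" by simp
  have ZCZ: "transpose_mat Z * C * Z = mat (Suc n) (Suc n) (\<lambda>(i, j). if i = j then (e # es) ! i else 0)"
  proof -
    have "transpose_mat Z * C = four_block_mat (mat 1 1 (\<lambda>_. e)) (0\<^sub>m 1 n) (0\<^sub>m n 1) (transpose_mat U' * A')"
      unfolding ZT Cblock using U' A'
      by (subst mult_four_block_mat[of _ 1 1 _ n _ n _ _ 1 _ n]) auto
    then have "transpose_mat Z * C * Z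
        = four_block_mat (mat 1 1 (\<lambda>_. e)) (0\<^sub>m 1 n) (0\<^sub>m n 1) (transpose_mat U' * A' * U')"
      unfolding Z_def using U' A'
      by simp (subst mult_four_block_mat[of _ 1 1 _ n _ n _ _ 1 _ n], auto)
    then show ?thesis
      unfolding U'(4) by (intro eq_matI) (auto simp: nth_Cons')
  qed
  have "transpose_mat (W * Z) = transpose_mat Z * W" using W Z by (simp add: transpose_mult)
  then have "transpose_mat (W * Z) * (W * Z) = transpose_mat Z * (W * W) * Z"
    "transpose_mat (W * Z) * A * (W * Z) = transpose_mat Z * C * Z"
    unfolding C_def using W(1) Z A
    by (simp_all add: assoc_mult_mat[of _ "Suc n" "Suc n" _ "Suc n" _ "Suc n"])
  then show ?case
    using W(1,3) Z ZZ ZCZ U'(3)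
    by (intro exI[of _ "W * Z"] exI[of _ "e # es"]) simp
qed

text \<open>
  The spectral theorem in the form in which it is used: with the characteristic roots as
  coefficients, and with new coordinates that preserve the Euclidean norm, so that subtracting
  \<open>\<mu> |x|\<^sup>2\<close> just shifts the coefficients by \<open>\<mu>\<close>.
\<close>
lemma symmetric_mat_diagonalization:
  fixes A :: "real mat"
  assumes A: "A \<in> carrier_mat n n" and sym: "transpose_mat A = A"
  shows "\<exists>u es. length es = n \<and> char_poly A = (\<Prod>e\<leftarrow>es. [:- e, 1:]) \<and>
    (\<forall>x. (\<Sum>i<n. (x i)\<^sup>2) = (\<Sum>k<n. (\<Sum>i<n. u k i * x i)\<^sup>2)) \<and>
    (\<forall>x. (\<Sum>i<n. \<Sum>j<n. A $$ (i, j) * (x i * x j)) = (\<Sum>k<n. es ! k * (\<Sum>i<n. u k i * x i)\<^sup>2))"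
proof -
  obtain U es where U: "U \<in> carrier_mat n n" "transpose_mat U * U = 1\<^sub>m n" "length es = n"
    and UAU: "transpose_mat U * A * U = mat n n (\<lambda>(i, j). if i = j then es ! i else 0)"
    using spectral_theorem_real_symmetric[OF A sym] by blast
  let ?D = "mat n n (\<lambda>(i, j). if i = j then es ! i else 0)"
  \<comment> \<open>A left inverse of a square matrix is also a right inverse.\<close>
  have UU: "U * transpose_mat U = 1\<^sub>m n"
    using U by (intro mat_mult_left_right_inverse[of "transpose_mat U"]) auto
  have "U * ?D * transpose_mat U = (U * transpose_mat U) * A * (U * transpose_mat U)"
    unfolding UAU[symmetric] using U(1) A by (simp add: assoc_mult_mat[of _ n n _ n _ n])
  then have AD: "A = U * ?D * transpose_mat U" unfolding UU using A by simp
  have "similar_mat A ?D"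
    by (rule similar_matI[of _ _ U "transpose_mat U" n]) (use U UU A AD in auto)
  then have "char_poly A = char_poly ?D" by (rule char_poly_similar)
  also have "\<dots> = (\<Prod>e\<leftarrow>diag_mat ?D. [:- e, 1:])"
    by (rule char_poly_upper_triangular[of _ n]) (auto simp: upper_triangular_def)
  also have "diag_mat ?D = es"
    by (rule nth_equalityI) (auto simp: diag_mat_def U(3))
  finally have cp: "char_poly A = (\<Prod>e\<leftarrow>es. [:- e, 1:])" .
  define u where "u k i = U $$ (i, k)" for k i
  have orth: "(\<Sum>k<n. u k i * u k j) = (if i = j then 1 else 0)" if "i < n" "j < n" for i j
    using arg_cong[OF UU, of "\<lambda>M. M $$ (i, j)"] that U(1)
    by (simp add: scalar_prod_def lessThan_atLeast0 u_def)
  have entry: "A $$ (i, j) = (\<Sum>k<n. es ! k * (u k i * u k j))" if "i < n" "j < n" for i j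
  proof -
    have UD: "(U * ?D) $$ (i, k) = U $$ (i, k) * es ! k" if "k < n" for k
    proof -
      have "(U * ?D) $$ (i, k) = (\<Sum>l<n. U $$ (i, l) * (if l = k then es ! l else 0))"
        using that \<open>i < n\<close> U(1) by (simp add: scalar_prod_def lessThan_atLeast0)
      then show ?thesis using that by (simp add: if_distrib cong: if_cong)
    qed
    have "A $$ (i, j) = (U * ?D * transpose_mat U) $$ (i, j)" using AD by simp
    also have "\<dots> = (\<Sum>k<n. (U * ?D) $$ (i, k) * U $$ (j, k))"
      using that U(1) by (simp add: scalar_prod_def lessThan_atLeast0)
    also have "\<dots> = (\<Sum>k<n. es ! k * (u k i * u k j))"
      by (rule sum.cong) (use UD in \<open>auto simp: u_def\<close>)
    finally show ?thesis .
  qed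
  have expand: "(\<Sum>k<n. c k * (\<Sum>i<n. u k i * x i)\<^sup>2)
      = (\<Sum>i<n. \<Sum>j<n. (\<Sum>k<n. c k * (u k i * u k j)) * (x i * x j))" for c x :: "nat \<Rightarrow> real"
  proof -
    have "(\<Sum>k<n. c k * (\<Sum>i<n. u k i * x i)\<^sup>2)
        = (\<Sum>k<n. \<Sum>i<n. \<Sum>j<n. c k * (u k i * u k j) * (x i * x j))"
      by (simp add: power2_eq_square sum_product sum_distrib_left mult_ac)
    also have "\<dots> = (\<Sum>i<n. \<Sum>k<n. \<Sum>j<n. c k * (u k i * u k j) * (x i * x j))"
      by (rule sum.swap)
    also have "\<dots> = (\<Sum>i<n. \<Sum>j<n. \<Sum>k<n. c k * (u k i * u k j) * (x i * x j))"
      by (intro sum.cong refl sum.swap)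
    finally show ?thesis by (simp add: sum_distrib_right)
  qed
  have "(\<Sum>k<n. (\<Sum>i<n. u k i * x i)\<^sup>2) = (\<Sum>i<n. (x i)\<^sup>2)" for x
  proof -
    have "(\<Sum>k<n. (\<Sum>i<n. u k i * x i)\<^sup>2) = (\<Sum>i<n. \<Sum>j<n. (if i = j then 1 else 0) * (x i * x j))"
      using expand[of "\<lambda>_. 1" x] orth by simp
    also have "\<dots> = (\<Sum>i<n. (x i)\<^sup>2)"
      by (rule sum.cong) (auto simp: if_distrib[of "\<lambda>t. t * _"] power2_eq_square cong: if_cong)
    finally show ?thesis .
  qed
  moreover have "(\<Sum>k<n. es ! k * (\<Sum>i<n. u k i * x i)\<^sup>2) = (\<Sum>i<n. \<Sum>j<n. A $$ (i, j) * (x i * x j))" for x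
    using expand[of "\<lambda>k. es ! k" x] entry by simp
  ultimately show ?thesis using cp U(3) by metis
qed

text \<open>
  In the descending list only the first \<open>k - 1\<close> entries can exceed the \<open>k\<close>-th one.
\<close>
lemma kth_eigenvalue_counts:
  assumes cp: "char_poly A = (\<Prod>e\<leftarrow>es. [:- e, 1:])" and k: "1 \<le> k" "k \<le> length es"
  shows "card {i \<in> {..<length es}. es ! i - kth_eigenvalue k A > 0} \<le> k - 1"
    and "eigenvalue_multiplicity A \<mu> = card {i \<in> {..<length es}. es ! i = \<mu>}"
proof -
  have "proots (\<Prod>e\<leftarrow>xs. [:- e, 1:]) = mset xs" for xs :: "real list"
  proof (induction xs)
    case (Cons a xs)
    have "(\<Prod>e\<leftarrow>xs. [:- e, 1:]) \<noteq> 0" by (auto simp: prod_list_zero_iff)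
    then show ?case using Cons by (simp add: proots_mult del: mult_pCons_left)
  qed simp
  then have pr: "proots (char_poly A) = mset es" unfolding cp .
  define ds where "ds = rev (sort es)"
  have ds: "mset ds = mset es" "length ds = length es" "sorted (rev ds)" unfolding ds_def by auto
  define lam where "lam = kth_eigenvalue k A"
  have lam_nth: "lam = ds ! (k - 1)"
    unfolding lam_def kth_eigenvalue_def eigenvalues_desc_def pr ds_def by simp
  have "card {i \<in> {..<length es}. es ! i > lam} = length (filter (\<lambda>e. e > lam) es)"
    by (simp add: length_filter_conv_card)
  also have "\<dots> = length (filter (\<lambda>e. e > lam) ds)"
    using ds(1) by (metis mset_filter size_mset)
  also have "\<dots> = card {i. i < length ds \<and> ds ! i > lam}"
    by (simp add: length_filter_conv_card)
  also have "\<dots> \<le> card {..<k - 1}"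
  proof (rule card_mono)
    show "{i. i < length ds \<and> ds ! i > lam} \<subseteq> {..<k - 1}"
    proof
      fix i assume "i \<in> {i. i < length ds \<and> ds ! i > lam}"
      then have "i < length ds" "\<not> ds ! i \<le> ds ! (k - 1)" unfolding lam_nth by auto
      then show "i \<in> {..<k - 1}" using sorted_rev_nth_mono[OF ds(3), of "k - 1" i] by (meson lessThan_iff not_less)
    qed
  qed simp
  finally show "card {i \<in> {..<length es}. es ! i - kth_eigenvalue k A > 0} \<le> k - 1"
    unfolding lam_def by simp
  have "char_poly A \<noteq> 0" unfolding cp by (auto simp: prod_list_zero_iff)
  then have "eigenvalue_multiplicity A \<mu> = count (mset es) \<mu>"
    unfolding eigenvalue_multiplicity_def pr[symmetric] by simp
  also have "\<dots> = card {i \<in> {..<length es}. es ! i = \<mu>}"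
    unfolding count_mset count_list_eq_length_filter length_filter_conv_card
    by (rule arg_cong[of _ _ card]) auto
  finally show "eigenvalue_multiplicity A \<mu> = card {i \<in> {..<length es}. es ! i = \<mu>}" .
qed

section \<open>Spanning trees and the adjacency form\<close>

text \<open>
  Every vertex other than the root \<open>r\<close> chooses as parent a vertex closer to \<open>r\<close>; the height \<open>h\<close>
  is the distance to \<open>r\<close>.
\<close>
lemma spanning_tree_towards_root:
  assumes fin: "finite V" and r: "r \<in> V" and reach: "\<And>v. v \<in> V \<Longrightarrow> (v, r) \<in> R\<^sup>*"
  shows "\<exists>F (h :: 'a \<Rightarrow> nat). F \<subseteq> R \<and> single_valued F \<and> card F + 1 = card V \<and> (\<forall>(v, u)\<in>F. h u < h v)"
proof -
  define h where "h v = (LEAST k. (v, r) \<in> R ^^ k)" for v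
  have "\<exists>u. (v, u) \<in> R \<and> h u < h v" if v: "v \<in> V - {r}" for v
  proof -
    have "\<exists>k. (v, r) \<in> R ^^ k" using reach v rtrancl_imp_relpow by blast
    then have hv: "(v, r) \<in> R ^^ h v" unfolding h_def by (rule LeastI_ex)
    then obtain k where k: "h v = Suc k" using v by (cases "h v") auto
    then obtain u where u: "(v, u) \<in> R" "(u, r) \<in> R ^^ k" using hv by (metis relpow_Suc_D2)
    then have "h u \<le> k" unfolding h_def by (intro Least_le)
    then show ?thesis using u(1) k by auto
  qed
  then obtain p where p: "\<And>v. v \<in> V - {r} \<Longrightarrow> (v, p v) \<in> R \<and> h (p v) < h v" by metis
  define F where "F = (\<lambda>v. (v, p v)) ` (V - {r})"
  have "F \<subseteq> R" "\<forall>(v, u)\<in>F. h u < h v" using p unfolding F_def by auto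
  moreover have "single_valued F" unfolding F_def single_valued_def by auto
  moreover have "card F + 1 = card V"
    unfolding F_def using card_Suc_Diff1[OF fin r] by (simp add: card_image inj_on_def)
  ultimately show ?thesis by blast
qed

lemma connected_graph_rtrancl:
  assumes G: "pair_graph G" and conn: "connected (with_proj G)" and "u \<in> pverts G" "v \<in> pverts G"
  shows "(u, v) \<in> (parcs G)\<^sup>*"
proof -
  interpret pair_graph G by (rule G)
  have "u \<rightarrow>\<^sup>*\<^bsub>with_proj (mk_symmetric (with_proj G))\<^esub> v"
    using conn assms(3,4) unfolding connected_def strongly_connected_def by simp
  then have "u \<rightarrow>\<^sup>*\<^bsub>with_proj G\<^esub> v"
    using reachable_mk_symmetric_eq sym_arcs by blast
  then show ?thesis unfolding reachable_def by (auto dest: rtrancl_on_rtranclI)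
qed

text \<open>
  Two arcs with the same ends that both go downwards in height are equal; hence the arcs of a
  spanning tree count its edges.
\<close>
lemma inj_on_unordered_ends:
  assumes "\<And>v u. (v, u) \<in> F \<Longrightarrow> h u < (h v :: nat)"
  shows "inj_on (\<lambda>(v, u). {v, u}) F"
proof (rule inj_onI, clarify)
  fix a b c d assume "(a, b) \<in> F" "(c, d) \<in> F" "{a, b} = {c, d}"
  then show "a = c \<and> b = d" using assms[of a b] assms[of c d] by (auto simp: doubleton_eq_iff)
qed

text \<open>
  Each edge \<open>e = {u, v}\<close> carries two arcs, which contribute \<open>2 x\<^sub>u x\<^sub>v\<close>; on the right this is written
  as the square of a linear form corrected by diagonal terms.
\<close>
lemma sum_arcs_eq_sum_edges:
  fixes x :: "'a \<Rightarrow> real"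
  assumes "pair_graph G"
  shows "(\<Sum>(u, v)\<in>parcs G. x u * x v) = (\<Sum>e\<in>edges G. (\<Sum>w\<in>e. x w)\<^sup>2 - (\<Sum>w\<in>e. (x w)\<^sup>2))"
proof -
  interpret pair_graph G by (rule assms)
  have "(\<Sum>(u, v)\<in>parcs G. x u * x v)
      = (\<Sum>e\<in>edges G. \<Sum>(u, v)\<in>{a \<in> parcs G. (\<lambda>(u, v). {u, v}) a = e}. x u * x v)"
    unfolding edges_def by (rule sum.image_gen) simp
  also have "\<dots> = (\<Sum>e\<in>edges G. (\<Sum>w\<in>e. x w)\<^sup>2 - (\<Sum>w\<in>e. (x w)\<^sup>2))"
  proof (rule sum.cong)
    fix e assume "e \<in> edges G"
    then obtain u v where uv: "(u, v) \<in> parcs G" "e = {u, v}" unfolding edges_def by auto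
    then have ne: "u \<noteq> v" and vu: "(v, u) \<in> parcs G"
      using pair_no_loops[of "(u, v)"] arcs_symmetric[of u v] by auto
    have ends: "{a \<in> parcs G. (\<lambda>(u, v). {u, v}) a = e} = {(u, v), (v, u)}"
    proof (intro equalityI subsetI)
      fix a assume "a \<in> {a \<in> parcs G. (\<lambda>(u, v). {u, v}) a = e}"
      then have "{fst a, snd a} = {u, v}" using uv(2) by (simp add: split_def)
      then show "a \<in> {(u, v), (v, u)}" by (cases a) (simp add: doubleton_eq_iff)
    next
      fix a assume "a \<in> {(u, v), (v, u)}"
      then show "a \<in> {a \<in> parcs G. (\<lambda>(u, v). {u, v}) a = e}"
        unfolding uv(2) using uv(1) vu by (elim insertE) (simp_all add: insert_commute)
    qed
    show "(\<Sum>(u, v)\<in>{a \<in> parcs G. (\<lambda>(u, v). {u, v}) a = e}. x u * x v)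
        = (\<Sum>w\<in>e. x w)\<^sup>2 - (\<Sum>w\<in>e. (x w)\<^sup>2)"
      unfolding ends unfolding uv(2) using ne by (simp add: power2_eq_square algebra_simps)
  qed simp
  finally show ?thesis .
qed

text \<open>
  The edges in \<open>C\<close> outside the forest become squares of linear forms, and their diagonal corrections are
  absorbed into the diagonal of the forest form.
\<close>
lemma adjacency_form_decomposition:
  fixes x :: "'a \<Rightarrow> real"
  assumes G: "pair_graph G" and F: "F \<subseteq> parcs G" "\<And>v u. (v, u) \<in> F \<Longrightarrow> h u < (h v :: nat)"
  defines "C \<equiv> edges G - (\<lambda>(v, u). {v, u}) ` F"
  shows "(\<Sum>(u, v)\<in>parcs G. x u * x v) - \<mu> * (\<Sum>v\<in>pverts G. (x v)\<^sup>2)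
    = forest_form (\<lambda>v. - \<mu> - card {e \<in> C. v \<in> e}) (pverts G) F x + (\<Sum>e\<in>C. (\<Sum>w\<in>e. x w)\<^sup>2)"
proof -
  interpret pair_graph G by (rule G)
  let ?T = "(\<lambda>(v, u). {v, u}) ` F" and ?g = "\<lambda>e. (\<Sum>w\<in>e. x w)\<^sup>2 - (\<Sum>w\<in>e. (x w)\<^sup>2)"
  have finE: "finite (edges G)" unfolding edges_def by simp
  have "?T \<subseteq> edges G" using F(1) unfolding edges_def by blast
  then have "(\<Sum>e\<in>edges G. ?g e) = (\<Sum>e\<in>C. ?g e) + (\<Sum>e\<in>?T. ?g e)"
    unfolding C_def by (rule sum.subset_diff[OF _ finE])
  moreover have "(\<Sum>e\<in>?T. ?g e) = (\<Sum>a\<in>F. ?g ((\<lambda>(v, u). {v, u}) a))"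
    using inj_on_unordered_ends[of F h] F(2) by (simp add: sum.reindex)
  moreover have "\<dots> = (\<Sum>(v, u)\<in>F. 2 * (x v * x u))"
  proof (rule sum.cong)
    fix a assume a: "a \<in> F"
    obtain v u where vu: "a = (v, u)" by fastforce
    then have "v \<noteq> u" using F(2)[of v u] a by auto
    then show "?g ((\<lambda>(v, u). {v, u}) a) = (case a of (v, u) \<Rightarrow> 2 * (x v * x u))"
      unfolding vu by (simp add: power2_eq_square algebra_simps)
  qed simp
  moreover have "\<dots> = 2 * (\<Sum>(v, u)\<in>F. x v * x u)"
    by (simp add: sum_distrib_left split_def)
  moreover have "(\<Sum>e\<in>C. \<Sum>w\<in>e. (x w)\<^sup>2) = (\<Sum>v\<in>pverts G. card {e \<in> C. v \<in> e} * (x v)\<^sup>2)"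
  proof -
    have "e \<subseteq> pverts G" if "e \<in> C" for e
      using that wellformed unfolding C_def edges_def by (auto dest: in_arcsD1 in_arcsD2)
    then have "(\<Sum>e\<in>C. \<Sum>w\<in>e. (x w)\<^sup>2) = (\<Sum>e\<in>C. \<Sum>w\<in>{w \<in> pverts G. w \<in> e}. (x w)\<^sup>2)"
      by (intro sum.cong) auto
    also have "\<dots> = (\<Sum>v\<in>pverts G. \<Sum>e\<in>{e \<in> C. v \<in> e}. (x v)\<^sup>2)"
      using finE unfolding C_def by (intro sum.swap_restrict) auto
    finally show ?thesis by simp
  qed
  ultimately show ?thesis
    unfolding sum_arcs_eq_sum_edges[OF G] forest_form_def
    by (simp add: sum_subtractf sum_distrib_left sum_negf algebra_simps)
qed

lemma card_in_neighbours_le_max_degree: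
  assumes G: "pair_graph G" and F: "F \<subseteq> parcs G"
  shows "card (F\<inverse> `` {u}) \<le> max_degree G"
proof (cases "F\<inverse> `` {u} = {}")
  case False
  interpret pair_graph G by (rule G)
  have u: "u \<in> pverts G" using False F by (auto dest: in_arcsD2)
  have "(\<lambda>v. (u, v)) ` (F\<inverse> `` {u}) \<subseteq> out_arcs (with_proj G) u"
    using F arcs_symmetric by (auto simp: out_arcs_def)
  then have "card ((\<lambda>v. (u, v)) ` (F\<inverse> `` {u})) \<le> out_degree (with_proj G) u"
    unfolding out_degree_def by (intro card_mono) auto
  also have "\<dots> \<le> max_degree G" unfolding max_degree_def using u by (intro Max_ge) auto
  finally show ?thesis by (simp add: card_image inj_on_def)
qed simp

text \<open>
  The Perron argument in variational form. Replacing \<open>x\<close> by \<open>|x|\<close> does not decrease the form,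
  so \<open>|x|\<close> also attains the maximum 0. If \<open>|x|\<close> vanishes at \<open>a\<close>, then raising the value there
  to \<open>t > 0\<close> changes the form by \<open>t s - \<mu> t\<^sup>2\<close>, where \<open>s\<close> is twice the sum of the values at the
  neighbours; for small \<open>t\<close> this would be positive unless \<open>s = 0\<close>. So zeros spread to all neighbours
  and, by connectedness, everywhere.
\<close>
lemma nonpositive_adjacency_form_zero:
  fixes x :: "'a \<Rightarrow> real"
  assumes G: "pair_graph G" and conn: "connected (with_proj G)"
    and neg: "\<And>y. (\<Sum>(u, v)\<in>parcs G. y u * y v) - \<mu> * (\<Sum>v\<in>pverts G. (y v)\<^sup>2) \<le> 0"
    and zero: "(\<Sum>(u, v)\<in>parcs G. x u * x v) - \<mu> * (\<Sum>v\<in>pverts G. (x v)\<^sup>2) = 0"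
    and r: "r \<in> pverts G" "x r = 0" and v: "v \<in> pverts G"
  shows "x v = 0"
proof -
  interpret pair_graph G by (rule G)
  define q where "q y = (\<Sum>(u, v)\<in>parcs G. y u * y v) - \<mu> * (\<Sum>v\<in>pverts G. (y v)\<^sup>2)" for y :: "'a \<Rightarrow> real"
  define z where "z v = \<bar>x v\<bar>" for v
  have "q x \<le> q z"
    unfolding q_def z_def by (simp add: split_def sum_mono flip: abs_mult)
  then have qz: "q z = 0" using neg[of z] zero unfolding q_def by simp
  have propagate: "z v = 0" if a: "z a = 0" "(a, v) \<in> parcs G" for a v
  proof -
    have aG: "a \<in> pverts G" using a(2) by (auto dest: in_arcsD1)
    define s where "s = (\<Sum>(u, w)\<in>parcs G. (if u = a then z w else 0) + (if w = a then z u else 0))"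
    have perturb: "q (z(a := t)) = t * s - \<mu> * t\<^sup>2" for t
    proof -
      have "(\<Sum>(u, w)\<in>parcs G. (z(a := t)) u * (z(a := t)) w)
          = (\<Sum>(u, w)\<in>parcs G. z u * z w + t * ((if u = a then z w else 0) + (if w = a then z u else 0)))"
      proof (rule sum.cong)
        fix e assume "e \<in> parcs G"
        then have "fst e \<noteq> snd e" by (rule pair_no_loops)
        then show "(case e of (u, w) \<Rightarrow> (z(a := t)) u * (z(a := t)) w)
            = (case e of (u, w) \<Rightarrow> z u * z w + t * ((if u = a then z w else 0) + (if w = a then z u else 0)))"
          using a(1) by (cases e) auto
      qed simp
      also have "\<dots> = (\<Sum>(u, w)\<in>parcs G. z u * z w) + t * s"
        unfolding s_def sum_distrib_left sum.distrib[symmetric] by (rule sum.cong) auto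
      finally have 1: "(\<Sum>(u, w)\<in>parcs G. (z(a := t)) u * (z(a := t)) w) = \<dots>" .
      have "(\<Sum>v\<in>pverts G - {a}. ((z(a := t)) v)\<^sup>2) = (\<Sum>v\<in>pverts G - {a}. (z v)\<^sup>2)"
        by (rule sum.cong) auto
      then have "(\<Sum>v\<in>pverts G. ((z(a := t)) v)\<^sup>2) = t\<^sup>2 + (\<Sum>v\<in>pverts G. (z v)\<^sup>2)"
        using aG a(1) by (simp add: sum.remove)
      then show ?thesis using 1 qz unfolding q_def by (simp add: algebra_simps)
    qed
    have nonneg: "(case e of (u, w) \<Rightarrow> (if u = a then z w else 0) + (if w = a then z u else 0)) \<ge> 0" for e
      unfolding z_def by (auto split: prod.splits)
    have "s \<le> 0"
    proof (rule ccontr)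
      assume "\<not> s \<le> 0"
      \<comment> \<open>Any \<open>t\<close> with \<open>0 < t\<close> and \<open>\<mu> t < s\<close> serves; this one is also defined for \<open>\<mu> \<le> 0\<close>.\<close>
      define t where "t = s / (\<bar>\<mu>\<bar> + 1)"
      have t: "t > 0" using \<open>\<not> s \<le> 0\<close> unfolding t_def by simp
      have "\<mu> * t \<le> \<bar>\<mu>\<bar> * t" using t by (simp add: mult_right_mono)
      also have "\<dots> < (\<bar>\<mu>\<bar> + 1) * t" using t by simp
      also have "\<dots> = s" unfolding t_def by (simp add: add_nonneg_eq_0_iff)
      finally have "t * (\<mu> * t) < t * s" using t by simp
      then have "q (z(a := t)) > 0" unfolding perturb by (simp add: power2_eq_square mult_ac)
      then show False using neg[of "z(a := t)"] unfolding q_def by simp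
    qed
    moreover have "s \<ge> 0" unfolding s_def by (intro sum_nonneg nonneg)
    ultimately have "s = 0" by simp
    then have "\<forall>e\<in>parcs G. (case e of (u, w) \<Rightarrow> (if u = a then z w else 0) + (if w = a then z u else 0)) = 0"
      unfolding s_def by (subst (asm) sum_nonneg_eq_0_iff) (use nonneg in auto)
    then have "z v + (if v = a then z a else 0) = 0" using a(2) by force
    then show "z v = 0" using a(1) by (auto split: if_splits)
  qed
  have "(r, v) \<in> (parcs G)\<^sup>*" using connected_graph_rtrancl[OF G conn r(1) v] .
  then have "z v = 0"
  proof (induction rule: rtrancl_induct)
    case base
    show ?case using r(2) by (simp add: z_def)
  next
    case (step a b)
    then show ?case using propagate by blast
  qed
  then show ?thesis unfolding z_def by simp
qed

lemma adjacency_mat_form: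
  fixes x :: "'a \<Rightarrow> real"
  assumes G: "pair_graph G" and vs: "distinct vs" "set vs = pverts G"
  shows "(\<Sum>i<length vs. \<Sum>j<length vs. adjacency_mat vs G $$ (i, j) * (x (vs ! i) * x (vs ! j)))
    = (\<Sum>(u, v)\<in>parcs G. x u * x v)"
proof -
  interpret pair_graph G by (rule G)
  have bij: "bij_betw ((!) vs) {..<length vs} (pverts G)"
    using bij_betw_nth[OF vs(1) refl] vs(2) by auto
  let ?a = "\<lambda>u v. (if (u, v) \<in> parcs G then 1 else 0) * (x u * x v)"
  have "(\<Sum>i<length vs. \<Sum>j<length vs. adjacency_mat vs G $$ (i, j) * (x (vs ! i) * x (vs ! j)))
      = (\<Sum>i<length vs. \<Sum>j<length vs. ?a (vs ! i) (vs ! j))"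
    by (intro sum.cong) (auto simp: adjacency_mat_def)
  also have "\<dots> = (\<Sum>i<length vs. \<Sum>v\<in>pverts G. ?a (vs ! i) v)"
    by (intro sum.cong refl sum.reindex_bij_betw[OF bij])
  also have "\<dots> = (\<Sum>u\<in>pverts G. \<Sum>v\<in>pverts G. ?a u v)"
    by (rule sum.reindex_bij_betw[OF bij, of "\<lambda>u. \<Sum>v\<in>pverts G. ?a u v"])
  also have "\<dots> = (\<Sum>(u, v)\<in>pverts G \<times> pverts G. ?a u v)"
    by (rule sum.cartesian_product)
  also have "\<dots> = (\<Sum>(u, v)\<in>parcs G. x u * x v)"
    by (rule sum.mono_neutral_cong_right) (auto dest: in_arcsD1 in_arcsD2)
  finally show ?thesis .
qed

section \<open>The multiplicity bound\<close>

text \<open>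
  The diagonal form of \<open>A - \<mu>\<close>, transported from matrix indices to vertices: positive coefficients
  are the eigenvalues above \<open>\<mu>\<close>, zero coefficients the copies of \<open>\<mu>\<close>.
\<close>
lemma adjacency_form_spectral:
  fixes G :: "'a pair_pre_digraph"
  assumes G: "pair_graph G" and vs: "distinct vs" "set vs = pverts G" and k: "1 \<le> k" "k \<le> card (pverts G)"
  defines "A \<equiv> adjacency_mat vs G"
  defines "\<mu> \<equiv> kth_eigenvalue k A"
  obtains y e where "\<And>i. i < card (pverts G) \<Longrightarrow> linear_form (pverts G) (y i)"
    and "\<And>x. (\<Sum>(u, v)\<in>parcs G. x u * x v) - \<mu> * (\<Sum>v\<in>pverts G. (x v)\<^sup>2)
      = (\<Sum>i<card (pverts G). e i * (y i x)\<^sup>2)"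
    and "card {i \<in> {..<card (pverts G)}. e i > 0} \<le> k - 1"
    and "eigenvalue_multiplicity A \<mu> = card {i \<in> {..<card (pverts G)}. e i = 0}"
proof -
  interpret pair_graph G by (rule G)
  define n where "n = card (pverts G)"
  have n: "length vs = n" using vs distinct_card unfolding n_def by metis
  have A: "A \<in> carrier_mat n n" unfolding A_def adjacency_mat_def n by simp
  have "transpose_mat A = A"
    unfolding A_def adjacency_mat_def using arcs_symmetric by (intro eq_matI) auto
  then obtain u es where es: "length es = n" and cp: "char_poly A = (\<Prod>e\<leftarrow>es. [:- e, 1:])"
    and norm: "\<And>x. (\<Sum>i<n. (x i)\<^sup>2) = (\<Sum>l<n. (\<Sum>i<n. u l i * x i)\<^sup>2)"
    and form: "\<And>x. (\<Sum>i<n. \<Sum>j<n. A $$ (i, j) * (x i * x j)) = (\<Sum>l<n. es ! l * (\<Sum>i<n. u l i * x i)\<^sup>2)"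
    using symmetric_mat_diagonalization[OF A] by blast
  have bij: "bij_betw ((!) vs) {..<n} (pverts G)"
    using bij_betw_nth[OF vs(1) refl] vs(2) n by auto
  define y where "y l x = (\<Sum>i<n. u l i * x (vs ! i))" for l and x :: "'a \<Rightarrow> real"
  show ?thesis
  proof (rule that)
    show "linear_form (pverts G) (y l)" for l
    proof -
      have "linear_form (pverts G) (\<lambda>x. u l i * x (vs ! i))" if "i < n" for i
        using that bij by (intro linear_form_scale linear_form_coordinate) (auto dest: bij_betwE)
      then show ?thesis unfolding y_def by (intro linear_form_sum) auto
    qed
    show "(\<Sum>(u, v)\<in>parcs G. x u * x v) - \<mu> * (\<Sum>v\<in>pverts G. (x v)\<^sup>2)
        = (\<Sum>l<card (pverts G). (es ! l - \<mu>) * (y l x)\<^sup>2)" for x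
    proof -
      have "(\<Sum>v\<in>pverts G. (x v)\<^sup>2) = (\<Sum>l<n. (y l x)\<^sup>2)"
        using sum.reindex_bij_betw[OF bij, of "\<lambda>v. (x v)\<^sup>2"] norm[of "\<lambda>i. x (vs ! i)"]
        unfolding y_def by simp
      moreover have "(\<Sum>(u, v)\<in>parcs G. x u * x v) = (\<Sum>l<n. es ! l * (y l x)\<^sup>2)"
        using form[of "\<lambda>i. x (vs ! i)"] adjacency_mat_form[OF G vs, of x]
        unfolding y_def A_def n by simp
      ultimately show ?thesis
        unfolding n_def[symmetric] by (simp add: left_diff_distrib sum_subtractf sum_distrib_left)
    qed
    show "card {i \<in> {..<card (pverts G)}. es ! i - \<mu> > 0} \<le> k - 1"
      using kth_eigenvalue_counts(1)[OF cp k(1)] k(2) es unfolding \<mu>_def n_def by simp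
    show "eigenvalue_multiplicity A \<mu> = card {i \<in> {..<card (pverts G)}. es ! i - \<mu> = 0}"
      using kth_eigenvalue_counts(2)[OF cp k(1), of \<mu>] k(2) es unfolding n_def by simp
  qed
qed

text \<open>
  With two zero coefficients there would be room for the additional condition \<open>x r = 0\<close>, and thus for
  a nonzero maximizer that vanishes at the vertex \<open>r\<close>.
\<close>
lemma largest_eigenvalue_simple:
  fixes G :: "'a pair_pre_digraph"
  assumes G: "pair_graph G" and conn: "connected (with_proj G)"
    and y: "\<And>i. i < card (pverts G) \<Longrightarrow> linear_form (pverts G) (y i)"
    and q: "\<And>x. (\<Sum>(u, v)\<in>parcs G. x u * x v) - \<mu> * (\<Sum>v\<in>pverts G. (x v)\<^sup>2)
      = (\<Sum>i<card (pverts G). e i * (y i x)\<^sup>2)"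
    and nonpos: "\<And>i. i < card (pverts G) \<Longrightarrow> e i \<le> 0"
  shows "card {i \<in> {..<card (pverts G)}. e i = 0} \<le> 1"
proof (rule ccontr)
  assume many: "\<not> ?thesis"
  interpret pair_graph G by (rule G)
  let ?n = "card (pverts G)"
  obtain r where r: "r \<in> pverts G"
    using conn unfolding connected_def strongly_connected_def by auto
  let ?K = "{i \<in> {..<?n}. e i \<noteq> 0} <+> {r}" and ?f = "case_sum y (\<lambda>s x. x s)"
  have "\<exists>x. (\<exists>v\<in>pverts G. x v \<noteq> 0) \<and> (\<forall>k\<in>?K. ?f k x = 0)"
  proof (rule homogeneous_system_nontrivial_solution)
    show "card ?K < ?n"
      using many card_filter_split[of "{..<?n}" "\<lambda>i. e i = 0"] by (simp add: card_Plus)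
  qed (use y linear_form_coordinate[OF finite_verts r] in auto)
  then obtain x where x: "\<exists>v\<in>pverts G. x v \<noteq> 0" and fx: "\<And>k. k \<in> ?K \<Longrightarrow> ?f k x = 0" by blast
  have "y i x = 0" if "i < ?n" "e i \<noteq> 0" for i using fx[of "Inl i"] that by auto
  then have "e i * (y i x)\<^sup>2 = 0" if "i < ?n" for i using that by (cases "e i = 0") auto
  then have "(\<Sum>(u, v)\<in>parcs G. x u * x v) - \<mu> * (\<Sum>v\<in>pverts G. (x v)\<^sup>2) = 0"
    unfolding q by (intro sum.neutral) auto
  moreover have "x r = 0" using fx[of "Inr r"] by auto
  moreover have "(\<Sum>(u, v)\<in>parcs G. z u * z v) - \<mu> * (\<Sum>v\<in>pverts G. (z v)\<^sup>2) \<le> 0" for z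
    unfolding q using nonpos by (intro sum_nonpos) (simp add: mult_nonpos_nonneg)
  ultimately have "x v = 0" if "v \<in> pverts G" for v
    using nonpositive_adjacency_form_zero[OF G conn, of \<mu> x r v] r that by blast
  then show False using x by blast
qed

theorem lemma3:
  fixes G :: "'a pair_pre_digraph" and vs :: "'a list" and k :: nat
  assumes "pair_graph G"
    and "Digraph_Component.connected (with_proj G)"
    and "distinct vs" and "set vs = pverts G"
    and "1 \<le> k" and "k \<le> card (pverts G)"
    and "k = 1 \<Longrightarrow> cyclomatic_number G \<noteq> 0"
  shows "int (eigenvalue_multiplicity (adjacency_mat vs G) (kth_eigenvalue k (adjacency_mat vs G)))
           \<le> (int k - 1) * int (max_degree G) + cyclomatic_number G"
proof -
  interpret pair_graph G by (rule assms(1))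
  let ?V = "pverts G" and ?A = "adjacency_mat vs G"
  let ?\<mu> = "kth_eigenvalue k ?A"
  let ?n = "card ?V" and ?m = "eigenvalue_multiplicity ?A ?\<mu>"
  obtain y e where y: "\<And>i. i < ?n \<Longrightarrow> linear_form ?V (y i)"
    and q: "\<And>x. (\<Sum>(u, v)\<in>parcs G. x u * x v) - ?\<mu> * (\<Sum>v\<in>?V. (x v)\<^sup>2) = (\<Sum>i<?n. e i * (y i x)\<^sup>2)"
    and above: "card {i \<in> {..<?n}. e i > 0} \<le> k - 1"
    and mult: "?m = card {i \<in> {..<?n}. e i = 0}"
    by (rule adjacency_form_spectral[OF assms(1,3-6)]) (rule that, assumption+)
  obtain r where r: "r \<in> ?V" using assms(2) unfolding connected_def strongly_connected_def by auto
  have "parcs G \<subseteq> ?V \<times> ?V" by (auto dest: in_arcsD1 in_arcsD2)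
  then obtain F and h :: "'a \<Rightarrow> nat" where F: "F \<subseteq> parcs G" "single_valued F" "card F + 1 = ?n"
    and h: "\<And>v u. (v, u) \<in> F \<Longrightarrow> h u < h v"
    using spanning_tree_towards_root[OF finite_verts r connected_graph_rtrancl[OF assms(1,2) _ r]]
    by blast
  have FV: "F \<subseteq> ?V \<times> ?V" using F(1) \<open>parcs G \<subseteq> ?V \<times> ?V\<close> by blast
  let ?T = "(\<lambda>(v, u). {v, u}) ` F"
  define C where "C = edges G - ?T"
  have finE: "finite (edges G)" unfolding edges_def by simp
  have TE: "?T \<subseteq> edges G" using F(1) unfolding edges_def by blast
  have "card (edges G) = card ?T + card C"
    unfolding C_def using finE TE by (simp add: card_Diff_subset finite_subset card_mono)
  moreover have "card ?T = card F" by (rule card_image[OF inj_on_unordered_ends[where h = h, OF h]])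
  ultimately have cyc: "cyclomatic_number G = int (card C)"
    unfolding cyclomatic_number_def using F(3) by simp
  show ?thesis
  proof (cases "k = 1")
    case True
    then have "{i \<in> {..<?n}. e i > 0} = {}" using above by simp
    then have nonpos: "e i \<le> 0" if "i < ?n" for i using that by force
    have "?m \<le> 1" unfolding mult by (rule largest_eigenvalue_simple[OF assms(1,2) y q nonpos])
    then show ?thesis using assms(7) True cyc by simp
  next
    case False
    then have k: "k \<ge> 2" using assms(5) by simp
    have "F \<noteq> {}" using F(3) k assms(6) by auto
    then obtain v u where "(v, u) \<in> F" by auto
    moreover have "finite (F\<inverse> `` {u})" by (rule finite_subset[of _ ?V]) (use FV in auto)
    ultimately have "card (F\<inverse> `` {u}) > 0" by (auto simp: card_gt_0_iff)
    then obtain D where D: "max_degree G = Suc D"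
      using card_in_neighbours_le_max_degree[OF assms(1) F(1), of u] by (cases "max_degree G") auto
    \<comment> \<open>Each edge outside the tree subtracts 1 from the diagonal at both of its ends.\<close>
    define b where "b v = - ?\<mu> - card {e \<in> C. v \<in> e}" for v
    have child: "card (F\<inverse> `` {w}) \<le> Suc D" for w
      using card_in_neighbours_le_max_degree[OF assms(1) F(1)] D by simp
    have "\<exists>d L. diagonalizes ?V (forest_form b ?V F) d L \<and>
        card {v \<in> ?V. d v = 0} + card F \<le> ?n + D * card {v \<in> ?V. d v > 0}"
      by (rule forest_form_diagonalization[where h = h, OF finite_verts FV F(2) _ child]) (rule h)
    then obtain d L where dl: "diagonalizes ?V (forest_form b ?V F) d L"
      and zeros: "card {v \<in> ?V. d v = 0} + card F \<le> ?n + D * card {v \<in> ?V. d v > 0}"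
      by blast
    define s where "s = card {v \<in> ?V. d v > 0}"
    define p where "p = card {i \<in> {..<?n}. e i > 0}"
    have edge_form: "linear_form ?V (\<lambda>x. \<Sum>w\<in>c. x w)" if "c \<in> C" for c
      using that in_arcsD1 in_arcsD2 unfolding C_def edges_def
      by (intro linear_form_sum linear_form_coordinate) auto
    have decomp: "(\<Sum>(u, v)\<in>parcs G. x u * x v) - ?\<mu> * (\<Sum>v\<in>?V. (x v)\<^sup>2)
        = forest_form b ?V F x + (\<Sum>c\<in>C. (\<Sum>w\<in>c. x w)\<^sup>2)" for x
      unfolding b_def C_def by (rule adjacency_form_decomposition[where h = h, OF assms(1) F(1) h])
    have finC: "finite C" using finE unfolding C_def by simp
    note inertia = inertia_comparison[OF finite_verts _ _ finC _ _ dl q decomp]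
    have "s \<le> p" unfolding s_def p_def by (rule inertia(1)) (use y edge_form in auto)
    have "card {i \<in> {..<?n}. e i \<ge> 0} \<le> card {v \<in> ?V. d v \<ge> 0} + card C"
      by (rule inertia(2)) (use y edge_form in auto)
    then have "p + ?m \<le> s + card {v \<in> ?V. d v = 0} + card C"
      unfolding p_def s_def mult
      by (simp only: card_nonneg_split[OF finite_lessThan] card_nonneg_split[OF finite_verts])
    moreover have "card {v \<in> ?V. d v = 0} \<le> 1 + D * s" using zeros F(3) unfolding s_def by simp
    ultimately have "?m \<le> 1 + D * s + card C" using \<open>s \<le> p\<close> by linarith
    also have "\<dots> \<le> 1 + D * (k - 1) + card C"
      using \<open>s \<le> p\<close> above unfolding p_def by (intro add_mono mult_le_mono) auto
    also have "1 + D * (k - 1) \<le> (k - 1) * max_degree G"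
      using k D by (cases k) (auto simp: algebra_simps)
    finally have "?m \<le> (k - 1) * max_degree G + card C" by simp
    then have "int ?m \<le> int ((k - 1) * max_degree G + card C)" by (simp only: of_nat_le_iff)
    then show ?thesis unfolding cyc using assms(5) by (simp add: of_nat_diff)
  qed
qed

end
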